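(* Let $G$ and $H$ be graphs, and let $k\ge 1$ be an integer. Then $$\left\lceil \frac{n(G)\,n(H)}{k+1}\right\rceil\le \gamma_k^{\mathrm L}(G\square H)\le \min\big\{\gamma_k^{\mathrm L}(G)\,n(H),\ \gamma_k^{\mathrm L}(H)\,n(G)\big\}.$$
   Context: All graphs are finite and simple; $n(G)=|V(G)|$, and $N_G(u)$ is the open neighborhood of $u$ in $G$. A set $D\subseteq V(G)$ is a dominating set if every vertex of $V(G)\setminus D$ has a neighbor in $D$. For an integer $k\ge 0$, a dominating set $D$ of $G$ is a $k$-limited dominating set if $|N_G(u)\setminus D|\le k$ for every $u\in D$. The $k$-limited domination number $\gamma_k^{\mathrm L}(G)$ is the minimum cardinality of a $k$-limited dominating set of $G$ (defined for all integers $k\ge 0$, including $k\ge\Delta(G)$). The Cartesian product $G\square H$ has vertex set $V(G)\times V(H)$, with $(g,h)$ and $(g',h')$ adjacent if and only if either $g=g'$ and $hh'\in E(H)$, or $h=h'$ and $gg'\in E(G)$. *)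

theory Defs
  imports Complex_Main "Graph_Theory.Pair_Digraph"
begin

text \<open>
  Finite simple graphs are the library's \<^locale>\<open>pair_graph\<close>: each undirected edge is
  represented by both of its orientations. As in the library, the null graph is allowed.
\<close>

definition nbhd :: "'a pair_pre_digraph \<Rightarrow> 'a \<Rightarrow> 'a set" where
  "nbhd G u = {v \<in> pverts G. (u, v) \<in> parcs G}"

definition dominating_set :: "'a pair_pre_digraph \<Rightarrow> 'a set \<Rightarrow> bool" where
  "dominating_set G D \<longleftrightarrow> D \<subseteq> pverts G \<and> (\<forall>v \<in> pverts G - D. nbhd G v \<inter> D \<noteq> {})"

definition limited_dominating_set :: "nat \<Rightarrow> 'a pair_pre_digraph \<Rightarrow> 'a set \<Rightarrow> bool" where
  "limited_dominating_set k G D \<longleftrightarrow>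
     dominating_set G D \<and> (\<forall>u \<in> D. card (nbhd G u - D) \<le> k)"

definition limited_domination_number :: "nat \<Rightarrow> 'a pair_pre_digraph \<Rightarrow> nat" where
  "limited_domination_number k G = Min (card ` {D. limited_dominating_set k G D})"

definition cartesian_product ::
  "'a pair_pre_digraph \<Rightarrow> 'b pair_pre_digraph \<Rightarrow> ('a \<times> 'b) pair_pre_digraph" (infixr \<open>\<box>\<close> 70) where
  "G \<box> H = \<lparr> pverts = pverts G \<times> pverts H,
     parcs = {((g, h), (g', h')) | g h g' h'.
       g = g' \<and> g \<in> pverts G \<and> (h, h') \<in> parcs H \<or>
       h = h' \<and> h \<in> pverts H \<and> (g, g') \<in> parcs G} \<rparr>"

lemma pair_graph_cartesian_product:
  assumes "pair_graph G" "pair_graph H"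
  shows "pair_graph (G \<box> H)"
proof -
  interpret G: pair_graph G by fact
  interpret H: pair_graph H by fact
  have sub: "parcs (G \<box> H) \<subseteq> pverts (G \<box> H) \<times> pverts (G \<box> H)"
    by (auto simp: cartesian_product_def dest: G.wellformed' H.wellformed')
  have fin: "finite (pverts (G \<box> H))"
    by (simp add: cartesian_product_def)
  show ?thesis
  proof
    fix e assume e: "e \<in> parcs (G \<box> H)"
    then show "fst e \<in> pverts (G \<box> H)" "snd e \<in> pverts (G \<box> H)"
      using sub by auto
    show "fst e \<noteq> snd e"
      using e by (auto simp: cartesian_product_def dest: G.pair_no_loops H.pair_no_loops)
  next
    show "finite (pverts (G \<box> H))" by (rule fin)
    show "finite (parcs (G \<box> H))"
      using sub fin by (meson finite_SigmaI finite_subset)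
    have "sym (parcs G)" "sym (parcs H)"
      using G.pair_sym_arcs H.pair_sym_arcs by (simp_all add: symmetric_def)
    then show "symmetric (G \<box> H)"
      by (auto simp: symmetric_def cartesian_product_def sym_def)
  qed
qed

text \<open>
  The vertex set itself is a \<open>k\<close>-limited dominating set, so the minimum is
  always taken over a finite nonempty set.
\<close>

lemma limited_domination_number_attained:
  assumes "pair_graph G"
  shows "\<exists>D. limited_dominating_set k G D \<and> card D = limited_domination_number k G"
    and "limited_dominating_set k G D \<Longrightarrow> limited_domination_number k G \<le> card D"
proof -
  interpret pair_graph G by fact
  let ?S = "{D. limited_dominating_set k G D}"
  have "?S \<subseteq> Pow (pverts G)"
    by (auto simp: limited_dominating_set_def dominating_set_def)
  then have fin: "finite ?S"
    by (rule finite_subset) simp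
  have "nbhd G u - pverts G = {}" for u
    by (auto simp: nbhd_def)
  then have "card (nbhd G u - pverts G) = 0" for u
    by (metis card.empty)
  then have "pverts G \<in> ?S"
    by (simp add: limited_dominating_set_def dominating_set_def)
  then have "Min (card ` ?S) \<in> card ` ?S"
    using fin by (intro Min_in) auto
  then show "\<exists>D. limited_dominating_set k G D \<and> card D = limited_domination_number k G"
    by (auto simp: limited_domination_number_def)
  show "limited_domination_number k G \<le> card D" if "limited_dominating_set k G D"
    using that fin by (simp add: limited_domination_number_def)
qed

end

theory Submission
  imports Defs
begin

text \<open>The lower bound is a covering count: in a \<open>k\<close>-limited dominating set
  \<open>D\<close> of any graph, each member accounts for itself and at most \<open>k\<close>
  vertices outside \<open>D\<close>, and domination makes these pieces cover everything.
  \<open>pair_graph_card_le_limited_dominating_set\<close> is this count, applied to a minimum set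
  of \<open>G \<box> H\<close>. For the upper bound, copy a minimum set of one factor into every
  layer of that factor. Each layer is dominated internally, and edges between layers join copies of
  the same vertex, so they never leave the set; the limit \<open>k\<close> is thus inherited
  (\<open>limited_dominating_set_times_pverts\<close>,
  \<open>limited_dominating_set_pverts_times\<close>).\<close>

lemma pair_graph_card_le_limited_dominating_set:
  assumes "pair_graph G" and D: "limited_dominating_set k G D"
  shows "card (pverts G) \<le> (k + 1) * card D"
proof -
  interpret pair_graph G by fact
  have fin: "finite D"
    using D by (auto simp: limited_dominating_set_def dominating_set_def intro: finite_subset)
  have fin_nbhd: "finite (nbhd G u)" for u
    by (simp add: nbhd_def)
  \<comment> \<open>Removing \<open>D\<close> from each neighborhood keeps every piece at size at
    most \<open>k + 1\<close>; members of \<open>D\<close> are covered by their own piece.\<close>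
  have "pverts G \<subseteq> (\<Union>u\<in>D. insert u (nbhd G u - D))"
  proof
    fix v assume v: "v \<in> pverts G"
    show "v \<in> (\<Union>u\<in>D. insert u (nbhd G u - D))"
    proof (cases "v \<in> D")
      case False
      then obtain u where "u \<in> D" "(v, u) \<in> parcs G"
        using D v by (fastforce simp: limited_dominating_set_def dominating_set_def nbhd_def)
      \<comment> \<open>Domination yields an arc from \<open>v\<close> to its dominator, while the
        pieces collect arcs leaving the dominator.\<close>
      moreover from this have "(u, v) \<in> parcs G"
        using pair_sym_arcs by (simp add: symmetric_def sym_def)
      ultimately show ?thesis
        using v False by (auto simp: nbhd_def)
    qed auto
  qed
  then have "card (pverts G) \<le> card (\<Union>u\<in>D. insert u (nbhd G u - D))"
    using fin fin_nbhd by (intro card_mono) auto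
  also have "\<dots> \<le> (\<Sum>u\<in>D. card (insert u (nbhd G u - D)))"
    by (rule card_UN_le[OF fin])
  also have "\<dots> \<le> (\<Sum>u\<in>D. k + 1)"
    using D by (intro sum_mono)
      (auto simp: limited_dominating_set_def card_insert_if fin_nbhd le_SucI)
  finally show ?thesis by (simp add: mult.commute)
qed

lemma pverts_cartesian_product: "pverts (G \<box> H) = pverts G \<times> pverts H"
  by (simp add: cartesian_product_def)

lemma nbhd_cartesian_product:
  assumes "g \<in> pverts G" "h \<in> pverts H"
  shows "nbhd (G \<box> H) (g, h) = {g} \<times> nbhd H h \<union> nbhd G g \<times> {h}"
  using assms by (auto simp: nbhd_def cartesian_product_def)

lemma limited_dominating_set_times_pverts:
  assumes D: "limited_dominating_set k G D"
  shows "limited_dominating_set k (G \<box> H) (D \<times> pverts H)"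
proof -
  have sub: "D \<subseteq> pverts G"
    using D by (simp add: limited_dominating_set_def dominating_set_def)
  \<comment> \<open>The neighbors in \<open>{g} \<times> nbhd H h\<close> all lie in
    \<open>D \<times> pverts H\<close>, so what remains is a copy of
    \<open>nbhd G g - D\<close>.\<close>
  have "nbhd (G \<box> H) (g, h) - D \<times> pverts H = (nbhd G g - D) \<times> {h}"
    if "g \<in> D" "h \<in> pverts H" for g h
    using that sub by (subst nbhd_cartesian_product) (auto simp: nbhd_def)
  then have "card (nbhd (G \<box> H) u - D \<times> pverts H) \<le> k" if "u \<in> D \<times> pverts H" for u
    using that D by (auto simp: limited_dominating_set_def card_cartesian_product)
  moreover have "nbhd (G \<box> H) v \<inter> D \<times> pverts H \<noteq> {}"
    if "v \<in> pverts (G \<box> H) - D \<times> pverts H" for v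
  proof -
    \<comment> \<open>Since \<open>h\<close> is a vertex of \<open>H\<close>, only \<open>g\<close>
      can keep \<open>v\<close> out of the set; a dominator \<open>u\<close> of \<open>g\<close>
      then gives \<open>(u, h)\<close> in the same layer.\<close>
    obtain g h where v: "v = (g, h)" "g \<in> pverts G" "h \<in> pverts H" "g \<notin> D"
      using \<open>v \<in> _\<close> by (auto simp: pverts_cartesian_product)
    then obtain u where "u \<in> nbhd G g" "u \<in> D"
      using D unfolding limited_dominating_set_def dominating_set_def by blast
    then show ?thesis
      using v by (auto simp: nbhd_cartesian_product)
  qed
  ultimately show ?thesis
    using sub by (auto simp: limited_dominating_set_def dominating_set_def pverts_cartesian_product)
qed

text \<open>The mirror image of the previous argument, carried out directly because
  \<open>G \<box> H\<close> and \<open>H \<box> G\<close> are isomorphic but not equal.\<close>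

lemma limited_dominating_set_pverts_times:
  assumes D: "limited_dominating_set k H D"
  shows "limited_dominating_set k (G \<box> H) (pverts G \<times> D)"
proof -
  have sub: "D \<subseteq> pverts H"
    using D by (simp add: limited_dominating_set_def dominating_set_def)
  have "nbhd (G \<box> H) (g, h) - pverts G \<times> D = {g} \<times> (nbhd H h - D)"
    if "g \<in> pverts G" "h \<in> D" for g h
    using that sub by (subst nbhd_cartesian_product) (auto simp: nbhd_def)
  then have "card (nbhd (G \<box> H) u - pverts G \<times> D) \<le> k" if "u \<in> pverts G \<times> D" for u
    using that D by (auto simp: limited_dominating_set_def card_cartesian_product)
  moreover have "nbhd (G \<box> H) v \<inter> pverts G \<times> D \<noteq> {}"
    if "v \<in> pverts (G \<box> H) - pverts G \<times> D" for v
  proof -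
    obtain g h where v: "v = (g, h)" "g \<in> pverts G" "h \<in> pverts H" "h \<notin> D"
      using \<open>v \<in> _\<close> by (auto simp: pverts_cartesian_product)
    then obtain u where "u \<in> nbhd H h" "u \<in> D"
      using D unfolding limited_dominating_set_def dominating_set_def by blast
    then show ?thesis
      using v by (auto simp: nbhd_cartesian_product)
  qed
  ultimately show ?thesis
    using sub by (auto simp: limited_dominating_set_def dominating_set_def pverts_cartesian_product)
qed

theorem theorem7:
  fixes G :: "'a pair_pre_digraph" and H :: "'b pair_pre_digraph" and k :: nat
  assumes "pair_graph G" and "pair_graph H" and "k \<ge> 1"
  shows "\<lceil>real (card (pverts G)) * real (card (pverts H)) / (real k + 1)\<rceil>
           \<le> int (limited_domination_number k (G \<box> H))
       \<and> limited_domination_number k (G \<box> H)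
           \<le> min (limited_domination_number k G * card (pverts H))
                 (limited_domination_number k H * card (pverts G))"
proof -
  let ?n = "limited_domination_number k"
  note GH = pair_graph_cartesian_product[OF assms(1,2)]
  obtain D where "limited_dominating_set k (G \<box> H) D" "card D = ?n (G \<box> H)"
    using limited_domination_number_attained(1)[OF GH] by blast
  then have "card (pverts G) * card (pverts H) \<le> (k + 1) * ?n (G \<box> H)"
    using pair_graph_card_le_limited_dominating_set[OF GH]
    by (fastforce simp: pverts_cartesian_product card_cartesian_product)
  then have "real (card (pverts G) * card (pverts H)) \<le> real ((k + 1) * ?n (G \<box> H))"
    by (rule of_nat_mono)
  then have lower: "real (card (pverts G)) * real (card (pverts H)) / (real k + 1) \<le> ?n (G \<box> H)"
    by (simp add: field_simps)
  obtain A where A: "limited_dominating_set k G A" "card A = ?n G"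
    using limited_domination_number_attained(1)[OF assms(1)] by blast
  obtain B where B: "limited_dominating_set k H B" "card B = ?n H"
    using limited_domination_number_attained(1)[OF assms(2)] by blast
  have "?n (G \<box> H) \<le> ?n G * card (pverts H)"
    using limited_domination_number_attained(2)[OF GH limited_dominating_set_times_pverts[OF A(1)]]
    by (simp add: card_cartesian_product A(2))
  moreover have "?n (G \<box> H) \<le> ?n H * card (pverts G)"
    using limited_domination_number_attained(2)[OF GH limited_dominating_set_pverts_times[OF B(1)]]
    by (simp add: card_cartesian_product B(2) mult.commute)
  \<comment> \<open>The domination number is an integer, so the real bound \<open>lower\<close>
    passes to the ceiling.\<close>
  ultimately show ?thesis
    using lower by (simp add: ceiling_le_iff)
qed

end
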